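(* Let $G$ be a connected metric graph with $\ell(G)$ leaves, cyclomatic number $\mathrm{cyc}(G)$, total length $\mathrm{len}(G)$ and radius $\mathrm{radius}(G)$. Then $$\mathrm{len}(G) \le \big(2\,\mathrm{cyc}(G) + \ell(G)\big)\cdot \mathrm{radius}(G).$$
   Context: A metric graph is the compact metric space obtained from a finite collection of compact intervals (edges) of positive length by identifying their endpoints in groups (the vertices); equivalently, it is a finite edge-weighted multigraph (loops and parallel edges allowed) in which all points in the interior of each edge are included and each edge is locally isometric to an interval whose length is the edge weight. Metric graphs are assumed connected. The distance $d_G(x,y)$ is the minimum length of a path in $G$ from $x$ to $y$. The radius is $\mathrm{radius}(G)=\min_{x\in G}\max_{y\in G} d_G(x,y)$, over all points of $G$ (not only vertices). The length $\mathrm{len}(G)$ is the sum of the lengths of the edges. A leaf is a vertex of degree one (a point having a small neighborhood homeomorphic to an interval with that point as an endpoint), and $\ell(G)$ is the number of leaves. The cyclomatic number is $\mathrm{cyc}(G)=|E|-|V|+1$ for any combinatorial graph $(V,E)$ describing $G$ (equivalently the first Betti number of $G$). *)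

theory Defs
  imports Complex_Main "Graph_Theory.Digraph_Component"
begin

text \<open>
  A metric graph is given by a finite connected multigraph \<open>G\<close> with positive edge lengths \<open>w\<close>.
  The direction of an arc of \<open>G\<close> only fixes a parametrisation of the corresponding edge by the
  interval \<open>{0..w e}\<close>, with \<open>0\<close> at the tail and \<open>w e\<close> at the head; adjacency, degrees and
  paths below ignore it.  The name \<open>connected\<close> is qualified because it also denotes the
  topological notion.
\<close>

locale metric_graph = fin_digraph G
  for G :: "('a, 'b) pre_digraph" (structure) +
  fixes w :: "'b \<Rightarrow> real"
  assumes length_pos: "e \<in> arcs G \<Longrightarrow> 0 < w e"
    and connected: "Digraph_Component.connected G"

text \<open>
  Points of the glued space: the classes of identified interval endpoints are the vertices, and
  every interior point of an interval is a class of its own.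
\<close>

datatype ('a, 'b) point = Vertex 'a | Inner 'b real

definition points :: "('a, 'b) pre_digraph \<Rightarrow> ('b \<Rightarrow> real) \<Rightarrow> ('a, 'b) point set" where
  "points G w = Vertex ` verts G \<union> {Inner e t | e t. e \<in> arcs G \<and> 0 < t \<and> t < w e}"

definition edge_point :: "('a, 'b) pre_digraph \<Rightarrow> ('b \<Rightarrow> real) \<Rightarrow> 'b \<Rightarrow> real \<Rightarrow> ('a, 'b) point" where
  "edge_point G w e t =
     (if t = 0 then Vertex (tail G e) else if t = w e then Vertex (head G e) else Inner e t)"

text \<open>
  \<open>is_path G w x p y\<close>: \<open>p\<close> is a piecewise linear path from \<open>x\<close> to \<open>y\<close>.  A segment \<open>(e, s, t)\<close>
  runs along the edge \<open>e\<close> from parameter \<open>s\<close> to parameter \<open>t\<close>, in either direction.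
\<close>

inductive is_path :: "('a, 'b) pre_digraph \<Rightarrow> ('b \<Rightarrow> real) \<Rightarrow>
    ('a, 'b) point \<Rightarrow> ('b \<times> real \<times> real) list \<Rightarrow> ('a, 'b) point \<Rightarrow> bool"
  for G :: "('a, 'b) pre_digraph" and w :: "'b \<Rightarrow> real" where
  Nil: "x \<in> points G w \<Longrightarrow> is_path G w x [] x"
| Cons: "\<lbrakk>e \<in> arcs G; s \<in> {0..w e}; t \<in> {0..w e}; is_path G w (edge_point G w e t) p y\<rbrakk>
    \<Longrightarrow> is_path G w (edge_point G w e s) ((e, s, t) # p) y"

definition path_length :: "('b \<times> real \<times> real) list \<Rightarrow> real" where
  "path_length p = (\<Sum>(e, s, t) \<leftarrow> p. \<bar>s - t\<bar>)"

text \<open>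
  The infima and the supremum in the next two definitions are attained, since the space is
  compact and has finitely many edges.
\<close>

definition graph_dist ::
    "('a, 'b) pre_digraph \<Rightarrow> ('b \<Rightarrow> real) \<Rightarrow> ('a, 'b) point \<Rightarrow> ('a, 'b) point \<Rightarrow> real" where
  "graph_dist G w x y = (INF p\<in>{p. is_path G w x p y}. path_length p)"

definition radius :: "('a, 'b) pre_digraph \<Rightarrow> ('b \<Rightarrow> real) \<Rightarrow> real" where
  "radius G w = (INF x\<in>points G w. SUP y\<in>points G w. graph_dist G w x y)"

definition total_length :: "('a, 'b) pre_digraph \<Rightarrow> ('b \<Rightarrow> real) \<Rightarrow> real" where
  "total_length G w = (\<Sum>e\<in>arcs G. w e)"

text \<open>A loop contributes two to the degree of its vertex.\<close>

definition degree :: "('a, 'b) pre_digraph \<Rightarrow> 'a \<Rightarrow> nat" where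
  "degree G v = in_degree G v + out_degree G v"

definition num_leaves :: "('a, 'b) pre_digraph \<Rightarrow> nat" where
  "num_leaves G = card {v \<in> verts G. degree G v = 1}"

definition cyc :: "('a, 'b) pre_digraph \<Rightarrow> int" where
  "cyc G = int (card (arcs G)) - int (card (verts G)) + 1"

end

theory Submission
  imports Defs
begin

text \<open>
  Fix a point \<open>x\<close>, made a vertex by subdividing its edge if necessary, let \<open>D\<close> be the distance
  from \<open>x\<close> and \<open>R\<close> its maximum.  Every edge \<open>e = uv\<close> has a point at distance
  \<open>(D u + D v + w e) / 2\<close> from \<open>x\<close>, so \<open>D u + D v + w e \<le> 2 * R\<close>.  Every vertex \<open>v \<noteq> x\<close> has an
  incident edge along which a shortest path arrives; for it the sum equals \<open>2 * D v\<close>, and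
  different vertices have different such edges.  The remaining edges number \<open>cyc G\<close>, so summing
  over all edges gives \<open>len + (\<Sum>v. deg v * D v) \<le> 2 * R * cyc G + 2 * (\<Sum>v. D v)\<close>, where only
  leaves contribute positively to \<open>\<Sum>v. (2 - deg v) * D v\<close>.  Lower bounds on distances come from
  1-Lipschitz functions vanishing at \<open>x\<close>, so that no shortest path needs to be constructed.
\<close>

section \<open>Counting edges against vertices\<close>

text \<open>Each \<open>v\<close> in \<open>V\<close> claims a parent edge, whose term is exactly
  \<open>2 * D v\<close>; the unclaimed edges contribute at most \<open>M\<close> each. It is
  applied with \<open>V\<close> the vertices other than the base point.\<close>

lemma sum_edges_le:
  fixes D :: "'v \<Rightarrow> real" and l :: "'e \<Rightarrow> real"
  assumes fin: "finite E" "finite V"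
    and pos: "\<And>e. e \<in> E \<Longrightarrow> 0 < l e"
    and bound: "\<And>e. e \<in> E \<Longrightarrow> D (a e) + D (b e) + l e \<le> M"
    and parent: "\<And>v. v \<in> V \<Longrightarrow>
      \<exists>e\<in>E. a e = v \<and> D v = D (b e) + l e \<or> b e = v \<and> D v = D (a e) + l e"
  shows "(\<Sum>e\<in>E. D (a e) + D (b e) + l e)
    \<le> 2 * (\<Sum>v\<in>V. D v) + M * (real (card E) - real (card V))"
proof -
  obtain p where p: "\<And>v. v \<in> V \<Longrightarrow> p v \<in> E \<and>
      (a (p v) = v \<and> D v = D (b (p v)) + l (p v) \<or> b (p v) = v \<and> D v = D (a (p v)) + l (p v))"
    using parent by metis
  have inj: "inj_on p V"
  proof (rule inj_onI)
    fix u v assume "u \<in> V" "v \<in> V" "p u = p v"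
    \<comment> \<open>Distinct vertices sharing a parent edge would be its two ends, each farther
      than the other by a positive length.\<close>
    then show "u = v" using p[of u] p[of v] pos[of "p u"] by auto
  qed
  have sub: "p ` V \<subseteq> E" using p by auto
  have "(\<Sum>e\<in>p ` V. D (a e) + D (b e) + l e) = (\<Sum>v\<in>V. 2 * D v)"
    unfolding sum.reindex[OF inj]
  proof (rule sum.cong)
    fix v assume "v \<in> V"
    then show "((\<lambda>e. D (a e) + D (b e) + l e) \<circ> p) v = 2 * D v" using p[of v] by auto
  qed simp
  moreover have "(\<Sum>e\<in>E - p ` V. D (a e) + D (b e) + l e) \<le> real (card (E - p ` V)) * M"
    using bound by (intro sum_bounded_above) auto
  moreover have "real (card (E - p ` V)) = real (card E) - real (card V)"
    using sub fin by (simp add: card_Diff_subset finite_subset card_image[OF inj] card_mono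
      flip: card_image[OF inj] of_nat_diff)
  ultimately show ?thesis
    using sum.subset_diff[OF sub fin(1), of "\<lambda>e. D (a e) + D (b e) + l e"]
    by (simp add: sum_distrib_right[symmetric] mult.commute)
qed

section \<open>Paths and distances\<close>

lemma path_length_nonneg: "0 \<le> path_length p"
  unfolding path_length_def by (rule sum_list_nonneg) auto

lemma path_length_append [simp]: "path_length (p @ q) = path_length p + path_length q"
  by (simp add: path_length_def)

lemma path_length_lipschitz:
  fixes F :: "('a, 'b) point \<Rightarrow> real"
  assumes "is_path G w x p y"
    and "\<And>e s t. e \<in> arcs G \<Longrightarrow> s \<in> {0..w e} \<Longrightarrow> t \<in> {0..w e} \<Longrightarrow>
      F (edge_point G w e t) - F (edge_point G w e s) \<le> \<bar>s - t\<bar>"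
  shows "F y - F x \<le> path_length p"
  using assms(1)
proof induction
  case (Cons e s t p y)
  then show ?case using assms(2)[of e s t] by (auto simp: path_length_def)
qed (simp add: path_length_def)

context metric_graph
begin

abbreviation dist where "dist \<equiv> graph_dist G w"
abbreviation pt where "pt \<equiv> edge_point G w"

lemma pt_0 [simp]: "pt e 0 = Vertex (tail G e)"
  by (simp add: edge_point_def)

lemma pt_length [simp]: "e \<in> arcs G \<Longrightarrow> pt e (w e) = Vertex (head G e)"
  using length_pos[of e] by (simp add: edge_point_def)

lemma pt_inner [simp]: "0 < t \<Longrightarrow> t < w e \<Longrightarrow> pt e t = Inner e t"
  by (simp add: edge_point_def)

lemma pt_in_points: "e \<in> arcs G \<Longrightarrow> t \<in> {0..w e} \<Longrightarrow> pt e t \<in> points G w"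
  by (auto simp: edge_point_def points_def)

text \<open>\<open>is_path\<close> grows paths at the start, while distances from a fixed
  \<open>x\<close> require growth at the end.\<close>

lemma is_path_extend:
  assumes "is_path G w x p y" "y = pt e s" "e \<in> arcs G" "s \<in> {0..w e}" "t \<in> {0..w e}"
  shows "is_path G w x (p @ [(e, s, t)]) (pt e t)"
  using assms
proof induction
  case (Nil x)
  then show ?case by (auto intro!: is_path.intros pt_in_points)
next
  case (Cons e' s' t' p y)
  then show ?case by (auto intro!: is_path.intros)
qed

lemma path_along_edge:
  assumes "\<exists>p. is_path G w x p (pt e s)" "e \<in> arcs G" "s \<in> {0..w e}" "t \<in> {0..w e}"
  shows "\<exists>p. is_path G w x p (pt e t)"
  using assms is_path_extend by blast

text \<open>Keeps the infimum in \<open>graph_dist\<close> off the empty set. Interior points are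
  joined to the tail of their edge, and vertices to each other by induction along
  \<open>mk_symmetric G\<close>, whose arcs are the edges in both directions.\<close>

lemma path_exists:
  assumes x: "x \<in> points G w" and y: "y \<in> points G w"
  shows "\<exists>p. is_path G w x p y"
proof -
  let ?P = "\<lambda>y. \<exists>p. is_path G w x p y"
  have start: "?P x" using x is_path.Nil by blast
  have "\<exists>u\<in>verts G. ?P (Vertex u)"
  proof (cases x)
    case (Vertex u)
    then show ?thesis using x start by (auto simp: points_def)
  next
    case (Inner e s)
    then have e: "e \<in> arcs G" "0 < s" "s < w e" using x by (auto simp: points_def)
    have "?P (pt e s)" using start Inner e by simp
    from path_along_edge[OF this e(1), of 0] e have "?P (pt e 0)" by simp
    then show ?thesis using e(1) by (intro bexI[of _ "tail G e"]) simp_all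
  qed
  then obtain u where u: "u \<in> verts G" "?P (Vertex u)" by blast
  have vertex: "?P (Vertex v)" if "v \<in> verts G" for v
  proof -
    interpret S: pair_wf_digraph "mk_symmetric G" ..
    have "u \<rightarrow>\<^sup>*\<^bsub>mk_symmetric G\<^esub> v"
      using connected that u(1) unfolding Digraph_Component.connected_def strongly_connected_def
      by simp
    then show ?thesis
    proof (induction rule: S.reachable_induct)
      case base
      then show ?case using u by simp
    next
      case (step a b)
      then obtain e where e: "e \<in> arcs G"
        "a = tail G e \<and> b = head G e \<or> a = head G e \<and> b = tail G e"
        by (auto simp: parcs_mk_symmetric)
      have ends: "0 \<in> {0..w e}" "w e \<in> {0..w e}" using length_pos[OF e(1)] by auto
      have "?P (pt e (w e)) \<longleftrightarrow> ?P (pt e 0)"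
        using path_along_edge[OF _ e(1) ends] path_along_edge[OF _ e(1) ends(2,1)] by blast
      then have "?P (Vertex (head G e)) \<longleftrightarrow> ?P (Vertex (tail G e))" using e(1) by simp
      then show ?case using e(2) step.IH by blast
    qed
  qed
  show ?thesis
  proof (cases y)
    case (Vertex v)
    then show ?thesis using y vertex by (auto simp: points_def)
  next
    case (Inner e s)
    then have e: "e \<in> arcs G" "0 < s" "s < w e" using y by (auto simp: points_def)
    have "?P (pt e 0)" using vertex[of "tail G e"] e by simp
    from path_along_edge[OF this e(1), of s] e have "?P (pt e s)" by simp
    then show ?thesis using Inner e by simp
  qed
qed

lemma bdd_below_path_lengths: "bdd_below (path_length ` {p. is_path G w x p y})"
  by (rule bdd_belowI[of _ 0]) (auto simp: path_length_nonneg)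

lemma dist_le: "is_path G w x p y \<Longrightarrow> dist x y \<le> path_length p"
  unfolding graph_dist_def by (intro cINF_lower bdd_below_path_lengths) simp

lemma dist_geI:
  assumes "x \<in> points G w" "y \<in> points G w" "\<And>p. is_path G w x p y \<Longrightarrow> c \<le> path_length p"
  shows "c \<le> dist x y"
  unfolding graph_dist_def using path_exists[OF assms(1,2)] assms(3)
  by (intro cINF_greatest) blast+

lemma dist_nonneg: "x \<in> points G w \<Longrightarrow> y \<in> points G w \<Longrightarrow> 0 \<le> dist x y"
  by (rule dist_geI) (auto simp: path_length_nonneg)

lemma dist_self:
  assumes "x \<in> points G w" shows "dist x x = 0"
proof -
  have "dist x x \<le> 0"
    using dist_le[OF is_path.Nil[OF assms]] by (simp add: path_length_def)
  then show ?thesis using dist_nonneg[OF assms assms] by simp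
qed

text \<open>Any path to \<open>pt e s\<close> can be prolonged along \<open>e\<close>; passing to
  the infimum over these paths gives the bound.\<close>

lemma dist_along_edge:
  assumes "x \<in> points G w" "e \<in> arcs G" "s \<in> {0..w e}" "t \<in> {0..w e}"
  shows "dist x (pt e t) \<le> dist x (pt e s) + \<bar>s - t\<bar>"
proof -
  have "dist x (pt e t) - \<bar>s - t\<bar> \<le> dist x (pt e s)"
  proof (rule dist_geI)
    fix p assume "is_path G w x p (pt e s)"
    from dist_le[OF is_path_extend[OF this refl assms(2-4)]]
    show "dist x (pt e t) - \<bar>s - t\<bar> \<le> path_length p"
      by (simp add: path_length_def)
  qed (use assms pt_in_points in auto)
  then show ?thesis by simp
qed

lemma dist_lipschitz:
  assumes "F x = 0" "x \<in> points G w" "y \<in> points G w"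
    and "\<And>e s t. e \<in> arcs G \<Longrightarrow> s \<in> {0..w e} \<Longrightarrow> t \<in> {0..w e} \<Longrightarrow>
      F (pt e t) - F (pt e s) \<le> \<bar>s - t\<bar>"
  shows "F y \<le> dist x y"
proof (rule dist_geI[OF assms(2,3)])
  fix p assume "is_path G w x p y"
  from path_length_lipschitz[OF this, of F] assms(1,4) show "F y \<le> path_length p" by simp
qed

text \<open>Needed for the supremum in \<open>radius\<close> to be an upper bound. Every point lies
  on an edge, so the sum of all vertex distances plus the total length is a crude bound.\<close>

lemma bdd_above_dist:
  assumes "x \<in> points G w"
  shows "bdd_above (dist x ` points G w)"
proof (rule bdd_aboveI2)
  let ?S = "\<Sum>v\<in>verts G. dist x (Vertex v)"
  have vertex: "dist x (Vertex v) \<le> ?S" if "v \<in> verts G" for v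
    using that assms by (intro member_le_sum dist_nonneg) (auto simp: points_def)
  fix y assume "y \<in> points G w"
  then show "dist x y \<le> ?S + total_length G w"
    unfolding points_def
  proof (elim UnE imageE CollectE exE conjE)
    fix v assume "y = Vertex v" "v \<in> verts G"
    moreover have "0 \<le> total_length G w"
      unfolding total_length_def using length_pos by (intro sum_nonneg) (auto intro: less_imp_le)
    ultimately show ?thesis using vertex[of v] by simp
  next
    fix e t assume e: "y = Inner e t" "e \<in> arcs G" "0 < t" "t < w e"
    have "dist x y \<le> dist x (Vertex (tail G e)) + t"
      using dist_along_edge[OF assms e(2), of 0 t] e by simp
    moreover have "w e \<le> total_length G w"
      unfolding total_length_def using e(2) length_pos
      by (intro member_le_sum) (auto intro: less_imp_le)
    ultimately show ?thesis using vertex[of "tail G e"] e by simp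
  qed
qed

section \<open>Potentials as lower bounds for the distance\<close>

text \<open>These are the constraints on the vertex values of a nonnegative function that vanishes
  at \<open>x\<close> and is 1-Lipschitz along edges.\<close>

definition potential :: "('a, 'b) point \<Rightarrow> ('a \<Rightarrow> real) \<Rightarrow> bool" where
  "potential x D \<longleftrightarrow>
    (\<forall>v\<in>verts G. 0 \<le> D v) \<and>
    (\<forall>e\<in>arcs G. D (head G e) \<le> D (tail G e) + w e \<and> D (tail G e) \<le> D (head G e) + w e) \<and>
    (case x of Vertex a \<Rightarrow> D a = 0 | Inner e s \<Rightarrow> D (tail G e) \<le> s \<and> D (head G e) \<le> w e - s)"

text \<open>
  The largest 1-Lipschitz extension of a potential to the edges that vanishes at \<open>x\<close>;
  \<open>D (tail G e) + t\<close> is repeated as a neutral element of the minimum on edges not containing \<open>x\<close>.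
\<close>

definition edge_value :: "('a, 'b) point \<Rightarrow> ('a \<Rightarrow> real) \<Rightarrow> 'b \<Rightarrow> real \<Rightarrow> real" where
  "edge_value x D e t = min (min (D (tail G e) + t) (D (head G e) + w e - t))
    (case x of Vertex a \<Rightarrow> D (tail G e) + t
      | Inner e' s \<Rightarrow> if e' = e then \<bar>t - s\<bar> else D (tail G e) + t)"

definition extension :: "('a, 'b) point \<Rightarrow> ('a \<Rightarrow> real) \<Rightarrow> ('a, 'b) point \<Rightarrow> real" where
  "extension x D y = (case y of Vertex v \<Rightarrow> D v | Inner e t \<Rightarrow> edge_value x D e t)"

text \<open>The potential constraints say precisely that the minimum in \<open>edge_value\<close>
  takes the vertex values at the two ends of the edge.\<close>

lemma extension_pt:
  assumes "potential x D" "x \<in> points G w" "e \<in> arcs G" "t \<in> {0..w e}"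
  shows "extension x D (pt e t) = edge_value x D e t"
proof -
  have diff: "D (head G e) \<le> D (tail G e) + w e" "D (tail G e) \<le> D (head G e) + w e"
    using assms(1,3) by (auto simp: potential_def)
  have inner: "0 < s" "s < w e" "D (tail G e) \<le> s" "D (head G e) \<le> w e - s" if "x = Inner e s" for s
    using assms(1,2) that by (auto simp: potential_def points_def)
  consider "t = 0" | "t = w e" | "0 < t" "t < w e" using assms(4) by force
  then show ?thesis
  proof cases
    case 1
    then show ?thesis using diff inner
      by (cases x) (auto simp: extension_def edge_value_def)
  next
    case 2
    then show ?thesis using diff inner assms(3)
      by (cases x) (auto simp: extension_def edge_value_def)
  qed (simp add: extension_def)
qed

text \<open>A minimum of 1-Lipschitz functions is 1-Lipschitz.\<close>

lemma edge_value_lipschitz: "edge_value x D e t - edge_value x D e s \<le> \<bar>s - t\<bar>"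
proof -
  let ?c = "\<lambda>t. case x of Vertex a \<Rightarrow> D (tail G e) + t
      | Inner e' s \<Rightarrow> if e' = e then \<bar>t - s\<bar> else D (tail G e) + t"
  have "?c t - ?c s \<le> \<bar>s - t\<bar>" by (cases x) auto
  moreover have "edge_value x D e t \<le> D (tail G e) + t" "edge_value x D e t \<le> D (head G e) + w e - t"
    "edge_value x D e t \<le> ?c t"
    by (simp_all add: edge_value_def)
  ultimately have "edge_value x D e t - \<bar>s - t\<bar> \<le> edge_value x D e s"
    unfolding edge_value_def[of x D e s] by (intro min.boundedI) linarith+
  then show ?thesis by simp
qed

text \<open>Together with \<open>potential_dist\<close>, this makes the distances from
  \<open>x\<close> the largest potential, the dual description of shortest paths.\<close>

lemma potential_le_dist:
  assumes D: "potential x D" and x: "x \<in> points G w" and y: "y \<in> points G w"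
  shows "extension x D y \<le> dist x y"
proof (rule dist_lipschitz[where F = "extension x D", OF _ x y])
  show "extension x D x = 0"
  proof (cases x)
    case (Inner e s)
    then have "e \<in> arcs G" "0 < s" "s < w e" using x by (auto simp: points_def)
    moreover from this(1) have "0 \<le> D (tail G e)" "0 \<le> D (head G e)"
      using D by (auto simp: potential_def)
    ultimately show ?thesis using Inner by (simp add: extension_def edge_value_def)
  next
    case (Vertex a)
    then show ?thesis using D by (simp add: potential_def extension_def)
  qed
next
  fix e s t assume "e \<in> arcs G" "s \<in> {0..w e}" "t \<in> {0..w e}"
  then show "extension x D (pt e t) - extension x D (pt e s) \<le> \<bar>s - t\<bar>"
    using edge_value_lipschitz[of x D e t s] by (simp add: extension_pt[OF D x])
qed

lemma potential_dist:
  assumes "x \<in> points G w"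
  shows "potential x (\<lambda>v. dist x (Vertex v))"
  unfolding potential_def
proof (intro conjI ballI)
  fix v assume "v \<in> verts G"
  then show "0 \<le> dist x (Vertex v)"
    using assms by (intro dist_nonneg) (auto simp: points_def)
next
  fix e assume "e \<in> arcs G"
  then show "dist x (Vertex (head G e)) \<le> dist x (Vertex (tail G e)) + w e"
    and "dist x (Vertex (tail G e)) \<le> dist x (Vertex (head G e)) + w e"
    using dist_along_edge[OF assms, of e 0 "w e"] dist_along_edge[OF assms, of e "w e" 0]
      length_pos[of e] by auto
next
  show "case x of Vertex a \<Rightarrow> dist x (Vertex a) = 0
    | Inner e s \<Rightarrow> dist x (Vertex (tail G e)) \<le> s \<and> dist x (Vertex (head G e)) \<le> w e - s"
  proof (cases x)
    case (Inner e s)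
    then have "e \<in> arcs G" "0 < s" "s < w e" using assms by (auto simp: points_def)
    then show ?thesis
      using dist_along_edge[OF assms, of e s 0] dist_along_edge[OF assms, of e s "w e"]
        dist_self[OF assms] Inner by auto
  qed (use dist_self[OF assms] in auto)
qed

text \<open>If no constraint were tight at \<open>v\<close>, raising the potential at \<open>v\<close> would exceed the distance.\<close>

lemma tight_constraint:
  assumes x: "x \<in> points G w" and v: "v \<in> verts G" "x \<noteq> Vertex v"
  defines "D \<equiv> \<lambda>v. dist x (Vertex v)"
  shows "(\<exists>e\<in>arcs G. tail G e = v \<and> D v = D (head G e) + w e) \<or>
    (\<exists>e\<in>arcs G. head G e = v \<and> D v = D (tail G e) + w e) \<or>
    (\<exists>e s. x = Inner e s \<and> (tail G e = v \<and> D v = s \<or> head G e = v \<and> D v = w e - s))"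
    (is ?tight)
proof (rule ccontr)
  assume not_tight: "\<not> ?tight"
  have D: "potential x D" unfolding D_def by (rule potential_dist[OF x])
  \<comment> \<open>\<open>C\<close> collects the upper bounds that the constraints put on the value
    at \<open>v\<close> when all other values are kept.\<close>
  define C where "C = (\<lambda>e. D (head G e) + w e) ` {e\<in>arcs G. tail G e = v}
    \<union> (\<lambda>e. D (tail G e) + w e) ` {e\<in>arcs G. head G e = v}
    \<union> (case x of Vertex a \<Rightarrow> {}
        | Inner e s \<Rightarrow> (if tail G e = v then {s} else {}) \<union> (if head G e = v then {w e - s} else {}))"
  have fin: "finite C" unfolding C_def by (auto split: point.splits)
  have "D v < c" if "c \<in> C" for c
  proof -
    have "D v \<le> c" "D v \<noteq> c"
      using that D not_tight unfolding C_def potential_def by (auto split: point.splits if_splits)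
    then show ?thesis by simp
  qed
  \<comment> \<open>The element \<open>D v + 1\<close> keeps the minimum defined when
    \<open>C\<close> is empty.\<close>
  then have less: "D v < Min (insert (D v + 1) C)" using fin by simp
  define D' where "D' = D(v := Min (insert (D v + 1) C))"
  have le: "D' v \<le> c" if "c \<in> C" for c using that fin by (simp add: D'_def)
  have ge: "D u \<le> D' u" for u using less by (simp add: D'_def)
  have other: "D' u = D u" if "u \<noteq> v" for u using that by (simp add: D'_def)
  have "potential x D'"
    unfolding potential_def
  proof (intro conjI ballI)
    fix u assume "u \<in> verts G"
    then show "0 \<le> D' u" using D ge[of u] unfolding potential_def by force
  next
    fix e assume e: "e \<in> arcs G"
    have D_e: "D (head G e) \<le> D (tail G e) + w e" "D (tail G e) \<le> D (head G e) + w e"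
      using D e unfolding potential_def by auto
    have "D' v \<le> D (tail G e) + w e" if "head G e = v"
      using that e by (intro le) (auto simp: C_def)
    then show "D' (head G e) \<le> D' (tail G e) + w e"
      using ge[of "tail G e"] other[of "head G e"] D_e by (cases "head G e = v") auto
    have "D' v \<le> D (head G e) + w e" if "tail G e = v"
      using that e by (intro le) (auto simp: C_def)
    then show "D' (tail G e) \<le> D' (head G e) + w e"
      using ge[of "head G e"] other[of "tail G e"] D_e by (cases "tail G e = v") auto
  next
    show "case x of Vertex a \<Rightarrow> D' a = 0
      | Inner e s \<Rightarrow> D' (tail G e) \<le> s \<and> D' (head G e) \<le> w e - s"
    proof (cases x)
      case (Vertex a)
      then show ?thesis using D v(2) other[of a] by (auto simp: potential_def)
    next
      case (Inner e s)
      then have "s \<in> C" if "tail G e = v" using that by (auto simp: C_def)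
      moreover have "w e - s \<in> C" if "head G e = v" using that Inner by (auto simp: C_def)
      ultimately show ?thesis
        using D Inner le[of s] le[of "w e - s"] other[of "tail G e"] other[of "head G e"]
        by (cases "tail G e = v"; cases "head G e = v") (auto simp: potential_def)
    qed
  qed
  from potential_le_dist[OF this x, of "Vertex v"] v(1) have "D' v \<le> D v"
    by (simp add: extension_def D_def points_def)
  then show False using less by (simp add: D'_def)
qed

section \<open>The graph subdivided at \<open>x\<close>\<close>

text \<open>The edges after \<open>x\<close> has been made a vertex. Recording them as parameter
  intervals of the old edges avoids building a new graph and transferring distances to it.\<close>

definition segments :: "('a, 'b) point \<Rightarrow> ('b \<times> real \<times> real) set" where
  "segments x = (case x of Vertex a \<Rightarrow> (\<lambda>e. (e, 0, w e)) ` arcs G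
    | Inner e s \<Rightarrow> (\<lambda>e. (e, 0, w e)) ` (arcs G - {e}) \<union> {(e, 0, s), (e, s, w e)})"

lemma finite_segments: "finite (segments x)"
  by (auto simp: segments_def split: point.splits)

lemma segments_pos: "(e, p, q) \<in> segments x \<Longrightarrow> x \<in> points G w \<Longrightarrow> p < q"
  using length_pos by (auto simp: segments_def points_def split: point.splits)

lemma inj_segment: "inj_on (\<lambda>e. (e, 0 :: real, w e)) A"
  by (rule inj_onI) simp

text \<open>Cutting an edge at \<open>x\<close> preserves length and adds only two terms
  \<open>D x\<close>, which vanish.\<close>

lemma sum_segments:
  assumes "x \<in> points G w" "D x = 0"
  shows "(\<Sum>(e, p, q)\<in>segments x. D (pt e p) + D (pt e q) + (q - p))
    = (\<Sum>e\<in>arcs G. D (Vertex (tail G e)) + D (Vertex (head G e))) + total_length G w"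
proof (cases x)
  case (Vertex a)
  then show ?thesis
    by (simp add: segments_def sum.reindex[OF inj_segment] total_length_def sum.distrib)
next
  case (Inner e s)
  then have e: "e \<in> arcs G" "0 < s" "s < w e" using assms by (auto simp: points_def)
  let ?f = "\<lambda>(e, p, q). D (pt e p) + D (pt e q) + (q - p)"
  let ?A = "(\<lambda>e. (e, 0, w e)) ` (arcs G - {e})"
  have "sum ?f (segments x) = sum ?f ?A + sum ?f {(e, 0, s), (e, s, w e)}"
    unfolding segments_def Inner by (subst sum.union_disjoint[symmetric]) auto
  also have "sum ?f {(e, 0, s), (e, s, w e)} = D (Vertex (tail G e)) + D (Vertex (head G e)) + w e"
    using e assms Inner by simp
  also have "sum ?f ?A = (\<Sum>e\<in>arcs G - {e}. D (Vertex (tail G e)) + D (Vertex (head G e)) + w e)"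
    by (simp add: sum.reindex[OF inj_segment])
  finally show ?thesis
    using sum.remove[OF finite_arcs e(1),
      of "\<lambda>e. D (Vertex (tail G e)) + D (Vertex (head G e)) + w e"]
    by (simp add: total_length_def sum.distrib)
qed

text \<open>The number of segments left once each vertex other than \<open>x\<close> has claimed its
  parent. For interior \<open>x\<close>, the extra segment balances the fact that no old vertex is
  removed.\<close>

lemma card_segments:
  assumes "x \<in> points G w"
  shows "real (card (segments x)) - real (card (Vertex ` verts G - {x})) = real_of_int (cyc G)"
proof (cases x)
  case (Vertex a)
  then have a: "a \<in> verts G" using assms by (auto simp: points_def)
  then have "card (verts G) \<ge> 1" using finite_verts by (simp add: Suc_le_eq card_gt_0_iff) blast
  moreover have "card (Vertex ` verts G - {x}) = card (verts G) - 1"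
    using a Vertex by (subst card_Diff_singleton) (auto simp: card_image inj_on_def)
  moreover have "card (segments x) = card (arcs G)"
    using Vertex by (simp add: segments_def card_image[OF inj_segment])
  ultimately show ?thesis by (simp add: cyc_def of_nat_diff)
next
  case (Inner e s)
  then have e: "e \<in> arcs G" "0 < s" "s < w e" using assms by (auto simp: points_def)
  have "card (segments x) = card ((\<lambda>e. (e, 0 :: real, w e)) ` (arcs G - {e}))
      + card {(e, 0, s), (e, s, w e)}"
    unfolding segments_def Inner by (subst card_Un_disjoint[symmetric]) auto
  then have "card (segments x) = card (arcs G - {e}) + 2"
    using e by (simp add: card_image[OF inj_segment])
  moreover have "card (arcs G) = Suc (card (arcs G - {e}))"
    using e(1) by (intro card.remove) auto
  moreover have "card (Vertex ` verts G - {x} :: ('a, 'b) point set) = card (verts G)"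
    using Inner by (subst Diff_triv) (auto simp: card_image inj_on_def)
  ultimately show ?thesis by (simp add: cyc_def)
qed

text \<open>The left-hand side is twice the distance from \<open>x\<close> to the farthest point of the segment.\<close>

lemma segment_le:
  assumes x: "x \<in> points G w" and bound: "\<And>y. y \<in> points G w \<Longrightarrow> dist x y \<le> R"
    and seg: "(e, p, q) \<in> segments x"
  shows "dist x (pt e p) + dist x (pt e q) + (q - p) \<le> 2 * R"
proof -
  define D where "D v = dist x (Vertex v)" for v
  have D: "potential x D" unfolding D_def by (rule potential_dist[OF x])
  have edge_le: "edge_value x D e t \<le> R" if "e \<in> arcs G" "t \<in> {0..w e}" for t
    using extension_pt[OF D x that] potential_le_dist[OF D x] bound pt_in_points[OF that]
    by force
  have arc: "e \<in> arcs G" using seg x by (auto simp: segments_def points_def split: point.splits)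
  then have nonneg: "0 \<le> D (tail G e)" "0 \<le> D (head G e)" using D by (auto simp: potential_def)
  have diff: "D (head G e) \<le> D (tail G e) + w e" "D (tail G e) \<le> D (head G e) + w e"
    using D arc by (auto simp: potential_def)
  consider (whole) "p = 0" "q = w e" "\<And>s. x \<noteq> Inner e s"
    | (first) s where "x = Inner e s" "p = 0" "q = s"
    | (second) s where "x = Inner e s" "p = s" "q = w e"
    using seg by (auto simp: segments_def split: point.splits)
  then show ?thesis
  proof cases
    case whole
    \<comment> \<open>The point where arriving from the tail and arriving from the head cost the
      same.\<close>
    let ?t = "(w e + D (head G e) - D (tail G e)) / 2"
    have "edge_value x D e ?t = (D (tail G e) + D (head G e) + w e) / 2"
      using whole by (auto simp: edge_value_def min_def field_simps split: point.splits)
    then show ?thesis using edge_le[of ?t] arc diff whole by (simp add: D_def)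
  next
    case first
    then have s: "0 < s" "s < w e" using x by (auto simp: points_def)
    have Ds: "D (tail G e) \<le> s" using D first by (auto simp: potential_def)
    \<comment> \<open>Here the balance is between arriving from the tail and arriving directly from
      \<open>x\<close>.\<close>
    let ?t = "(s - D (tail G e)) / 2"
    have "edge_value x D e ?t = (D (tail G e) + s) / 2"
      using first s Ds nonneg by (auto simp: edge_value_def min_def field_simps)
    then show ?thesis using edge_le[of ?t] arc first s Ds nonneg dist_self[OF x] by (simp add: D_def)
  next
    case second
    then have s: "0 < s" "s < w e" using x by (auto simp: points_def)
    have Ds: "D (head G e) \<le> w e - s" using D second by (auto simp: potential_def)
    let ?t = "(w e + s + D (head G e)) / 2"
    have "edge_value x D e ?t = (D (head G e) + w e - s) / 2"
      using second s Ds nonneg by (auto simp: edge_value_def min_def field_simps)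
    then show ?thesis using edge_le[of ?t] arc second s Ds nonneg dist_self[OF x] by (simp add: D_def)
  qed
qed

text \<open>A tight constraint at \<open>v\<close> singles out the last segment of a shortest path;
  this supplies the parents for \<open>sum_edges_le\<close>.\<close>

lemma parent_segment:
  assumes x: "x \<in> points G w" and v: "v \<in> verts G" "x \<noteq> Vertex v"
  shows "\<exists>(e, p, q)\<in>segments x.
    pt e p = Vertex v \<and> dist x (Vertex v) = dist x (pt e q) + (q - p) \<or>
    pt e q = Vertex v \<and> dist x (Vertex v) = dist x (pt e p) + (q - p)"
proof -
  define D where "D v = dist x (Vertex v)" for v
  have D: "potential x D" unfolding D_def by (rule potential_dist[OF x])
  \<comment> \<open>An edge with \<open>x\<close> in its interior cannot be tight from end to end,
    since both its ends are closer to \<open>x\<close> than \<open>w e\<close>. A tight edge is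
    therefore uncut.\<close>
  have whole: "(e, 0, w e) \<in> segments x" if "e \<in> arcs G"
    "tail G e = v \<and> D v = D (head G e) + w e \<or> head G e = v \<and> D v = D (tail G e) + w e" for e
  proof -
    have "x \<noteq> Inner e s" for s
    proof
      assume s: "x = Inner e s"
      then have "0 < s" "s < w e" using x by (auto simp: points_def)
      moreover have "D (tail G e) \<le> s" "D (head G e) \<le> w e - s"
        "0 \<le> D (tail G e)" "0 \<le> D (head G e)"
        using D s that(1) by (auto simp: potential_def)
      ultimately show False using that(2) by auto
    qed
    then show ?thesis using that(1) by (auto simp: segments_def split: point.splits)
  qed
  consider e where "e \<in> arcs G" "tail G e = v" "D v = D (head G e) + w e"
    | e where "e \<in> arcs G" "head G e = v" "D v = D (tail G e) + w e"
    | e s where "x = Inner e s" "tail G e = v" "D v = s"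
    | e s where "x = Inner e s" "head G e = v" "D v = w e - s"
    using tight_constraint[OF x v] unfolding D_def by blast
  then show ?thesis
  proof cases
    case 1
    then show ?thesis using whole[of e] by (intro bexI[of _ "(e, 0, w e)"]) (auto simp: D_def)
  next
    case 2
    then show ?thesis using whole[of e] by (intro bexI[of _ "(e, 0, w e)"]) (auto simp: D_def)
  next
    case 3
    then show ?thesis using x dist_self[OF x]
      by (intro bexI[of _ "(e, 0, s)"]) (auto simp: D_def segments_def points_def)
  next
    case 4
    then show ?thesis using x dist_self[OF x]
      by (intro bexI[of _ "(e, s, w e)"]) (auto simp: D_def segments_def points_def)
  qed
qed

section \<open>Degrees, leaves and the final estimate\<close>

text \<open>A weighted handshake identity: arcs are grouped by tail and by head, so a loop counts
  twice, as in \<open>degree\<close>.\<close>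

lemma sum_arc_ends:
  fixes D :: "'a \<Rightarrow> real"
  shows "(\<Sum>e\<in>arcs G. D (tail G e) + D (head G e)) = (\<Sum>v\<in>verts G. real (degree G v) * D v)"
proof -
  have "(\<Sum>e\<in>arcs G. D (tail G e)) = (\<Sum>v\<in>verts G. real (out_degree G v) * D v)"
    by (subst sum.group[OF finite_arcs finite_verts, of "tail G", symmetric])
      (auto simp: out_degree_def out_arcs_def)
  moreover have "(\<Sum>e\<in>arcs G. D (head G e)) = (\<Sum>v\<in>verts G. real (in_degree G v) * D v)"
    by (subst sum.group[OF finite_arcs finite_verts, of "head G", symmetric])
      (auto simp: in_degree_def in_arcs_def)
  ultimately show ?thesis
    by (simp add: sum.distrib degree_def algebra_simps)
qed

lemma degree_pos:
  assumes "e \<in> arcs G" "tail G e = v \<or> head G e = v"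
  shows "0 < degree G v"
  using assms unfolding degree_def in_degree_def out_degree_def
  by (auto simp: card_gt_0_iff in_arcs_def out_arcs_def)

text \<open>Stated for any base point and any bound \<open>R\<close> on its distances, so that no
  centre of the graph has to be found.\<close>

lemma total_length_le:
  assumes x: "x \<in> points G w" and bound: "\<And>y. y \<in> points G w \<Longrightarrow> dist x y \<le> R"
  shows "total_length G w \<le> (2 * real_of_int (cyc G) + real (num_leaves G)) * R"
proof -
  define D where "D v = dist x (Vertex v)" for v
  have R: "0 \<le> R" using bound[OF x] dist_self[OF x] by simp
  have D_R: "0 \<le> D v" "D v \<le> R" if "v \<in> verts G" for v
    using that bound dist_nonneg[OF x] by (auto simp: D_def points_def)
  let ?V = "Vertex ` verts G - {x}"
  \<comment> \<open>\<open>sum_edges_le\<close> for the subdivided graph: vertices are points, edges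
    are triples, and \<open>M\<close> is \<open>2 * R\<close>.\<close>
  have "(\<Sum>e\<in>segments x. dist x (case e of (e, p, q) \<Rightarrow> pt e p) + dist x (case e of (e, p, q) \<Rightarrow> pt e q)
        + (case e of (e, p, q) \<Rightarrow> q - p))
      \<le> 2 * (\<Sum>v\<in>?V. dist x v) + 2 * R * (real (card (segments x)) - real (card ?V))"
  proof (rule sum_edges_le)
    fix u assume "u \<in> ?V"
    then show "\<exists>e\<in>segments x.
        (case e of (e, p, q) \<Rightarrow> pt e p) = u
          \<and> dist x u = dist x (case e of (e, p, q) \<Rightarrow> pt e q) + (case e of (e, p, q) \<Rightarrow> q - p) \<or>
        (case e of (e, p, q) \<Rightarrow> pt e q) = u
          \<and> dist x u = dist x (case e of (e, p, q) \<Rightarrow> pt e p) + (case e of (e, p, q) \<Rightarrow> q - p)"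
      using parent_segment[OF x] by (fastforce split: prod.splits)
  qed (use finite_segments segments_pos[OF _ x] segment_le[OF x bound] in auto)
  moreover have "(\<Sum>e\<in>segments x. dist x (case e of (e, p, q) \<Rightarrow> pt e p)
        + dist x (case e of (e, p, q) \<Rightarrow> pt e q) + (case e of (e, p, q) \<Rightarrow> q - p))
      = (\<Sum>v\<in>verts G. real (degree G v) * D v) + total_length G w"
    using sum_segments[of x "dist x", OF x dist_self[OF x]] sum_arc_ends[of D]
    by (simp add: D_def case_prod_beta)
  moreover have "(\<Sum>v\<in>?V. dist x v) = (\<Sum>v\<in>verts G. D v)"
  proof -
    have "(\<Sum>v\<in>?V. dist x v) = (\<Sum>v\<in>Vertex ` verts G. dist x v)"
      using dist_self[OF x] by (intro sum.mono_neutral_left) auto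
    then show ?thesis by (simp add: sum.reindex inj_on_def D_def)
  qed
  ultimately have "total_length G w
      \<le> 2 * R * real_of_int (cyc G) + (\<Sum>v\<in>verts G. (2 - real (degree G v)) * D v)"
    using card_segments[OF x] by (simp add: algebra_simps sum_subtractf sum_distrib_left)
  also have "(\<Sum>v\<in>verts G. (2 - real (degree G v)) * D v)
      \<le> (\<Sum>v\<in>verts G. if degree G v = 1 then R else 0)"
  proof (rule sum_mono)
    fix v assume v: "v \<in> verts G"
    show "(2 - real (degree G v)) * D v \<le> (if degree G v = 1 then R else 0)"
    proof (cases "x = Vertex v")
      case True
      then have "D v = 0" using dist_self[OF x] by (simp add: D_def)
      then show ?thesis using R by simp
    next
      case False
      \<comment> \<open>Degree zero would give the coefficient 2; a tight constraint provides an
        incident edge. Thus the coefficient is 1 at leaves and at most 0 at other vertices.\<close>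
      have "degree G v > 0"
        using tight_constraint[OF x v False] x by (auto simp: points_def intro: degree_pos)
      then show ?thesis using D_R[OF v]
        by (cases "degree G v = 1") (auto intro!: mult_nonpos_nonneg)
    qed
  qed
  also have "\<dots> = real (num_leaves G) * R"
    by (simp add: num_leaves_def sum.If_cases Int_def)
  finally show ?thesis by (simp add: algebra_simps)
qed

end

theorem theorem1:
  fixes G :: "('a, 'b) pre_digraph" and w :: "'b \<Rightarrow> real"
  assumes "metric_graph G w"
  shows "total_length G w \<le> (2 * real_of_int (cyc G) + real (num_leaves G)) * radius G w"
proof -
  interpret metric_graph G w by (rule assms)
  let ?K = "2 * real_of_int (cyc G) + real (num_leaves G)"
  let ?ecc = "\<lambda>x. SUP y\<in>points G w. graph_dist G w x y"
  have upper: "dist x y \<le> ?ecc x" if "x \<in> points G w" "y \<in> points G w" for x y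
    by (rule cSUP_upper[OF that(2) bdd_above_dist[OF that(1)]])
  have total: "total_length G w \<le> ?K * ?ecc x" if "x \<in> points G w" for x
    by (rule total_length_le[OF that upper[OF that]])
  have ne: "points G w \<noteq> {}"
    using connected by (auto simp: Digraph_Component.connected_def strongly_connected_def points_def)
  show ?thesis
  \<comment> \<open>The infimum is not shown to be attained. A positive factor can be divided out
    before taking the infimum; for a factor at most 0, multiplying
    \<open>radius G w \<le> ?ecc x\<close> by it reverses the inequality in the desired
    direction.\<close>
  proof (cases "?K > 0")
    case True
    have "total_length G w / ?K \<le> radius G w"
      unfolding radius_def using total True
      by (intro cINF_greatest[OF ne]) (simp add: field_simps)
    then show ?thesis using True by (simp add: field_simps)
  next
    case False
    from ne obtain x where x: "x \<in> points G w" by blast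
    have "0 \<le> ?ecc y" if "y \<in> points G w" for y
      using upper[OF that that] dist_self[OF that] by simp
    then have "radius G w \<le> ?ecc x"
      unfolding radius_def by (intro cINF_lower[OF _ x] bdd_belowI2[of _ 0])
    then have "?K * ?ecc x \<le> ?K * radius G w"
      using False by (intro mult_left_mono_neg) auto
    then show ?thesis using total[OF x] by simp
  qed
qed

end
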